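(* Let $n \ge 1$ and let $A_1, \dots, A_5 \in \mathbb{H}^{n\times n}$ be quaternion Hermitian matrices. Then the set $$\left\{ \left( x^H A_1 x,\; x^H A_2 x,\; x^H A_3 x,\; x^H A_4 x,\; x^H A_5 x \right)^\top \;:\; x \in \mathbb{H}^n \right\} \subseteq \mathbb{R}^5$$ is a convex set.
   Context: $\mathbb{H}$ denotes the real quaternions, with basis $1, i, j, k$, where $i^2=j^2=k^2=ijk=-1$; the conjugate of $q = a+bi+cj+dk$ is $\overline{q} = a-bi-cj-dk$. Vectors in $\mathbb{H}^n$ are column vectors. For a quaternion matrix or vector $A$, $A^H = (\overline{A})^\top$ is the conjugate transpose. A square matrix $A \in \mathbb{H}^{n \times n}$ is Hermitian if $A = A^H$; in that case $x^H A x$ is real for every $x \in \mathbb{H}^n$. *)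

theory Defs
  imports "HOL-Analysis.Analysis"
begin

datatype quat = Quat (qRe: real) (qIm1: real) (qIm2: real) (qIm3: real)

lemma quat_eq_iff:
  "x = y \<longleftrightarrow> qRe x = qRe y \<and> qIm1 x = qIm1 y \<and> qIm2 x = qIm2 y \<and> qIm3 x = qIm3 y"
  by (auto intro: quat.expand)

instantiation quat :: real_algebra_1
begin

definition zero_quat :: quat where "0 = Quat 0 0 0 0"
definition one_quat :: quat where "1 = Quat 1 0 0 0"
definition plus_quat :: "quat \<Rightarrow> quat \<Rightarrow> quat" where
  "x + y = Quat (qRe x + qRe y) (qIm1 x + qIm1 y) (qIm2 x + qIm2 y) (qIm3 x + qIm3 y)"
definition uminus_quat :: "quat \<Rightarrow> quat" where
  "- x = Quat (- qRe x) (- qIm1 x) (- qIm2 x) (- qIm3 x)"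
definition minus_quat :: "quat \<Rightarrow> quat \<Rightarrow> quat" where
  "x - y = Quat (qRe x - qRe y) (qIm1 x - qIm1 y) (qIm2 x - qIm2 y) (qIm3 x - qIm3 y)"
definition scaleR_quat :: "real \<Rightarrow> quat \<Rightarrow> quat" where
  "r *\<^sub>R x = Quat (r * qRe x) (r * qIm1 x) (r * qIm2 x) (r * qIm3 x)"
definition times_quat :: "quat \<Rightarrow> quat \<Rightarrow> quat" where
  "x * y = Quat
    (qRe x * qRe y - qIm1 x * qIm1 y - qIm2 x * qIm2 y - qIm3 x * qIm3 y)
    (qRe x * qIm1 y + qIm1 x * qRe y + qIm2 x * qIm3 y - qIm3 x * qIm2 y)
    (qRe x * qIm2 y - qIm1 x * qIm3 y + qIm2 x * qRe y + qIm3 x * qIm1 y)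
    (qRe x * qIm3 y + qIm1 x * qIm2 y - qIm2 x * qIm1 y + qIm3 x * qRe y)"

instance
  by standard
    (simp_all add: quat_eq_iff zero_quat_def one_quat_def plus_quat_def uminus_quat_def
      minus_quat_def scaleR_quat_def times_quat_def algebra_simps)

end

lemma quat_sel_simps [simp]:
  "qRe 0 = 0" "qIm1 0 = 0" "qIm2 0 = 0" "qIm3 0 = 0"
  "qRe 1 = 1" "qIm1 1 = 0" "qIm2 1 = 0" "qIm3 1 = 0"
  "qRe (x + y) = qRe x + qRe y" "qIm1 (x + y) = qIm1 x + qIm1 y"
  "qIm2 (x + y) = qIm2 x + qIm2 y" "qIm3 (x + y) = qIm3 x + qIm3 y"
  "qRe (- x) = - qRe x" "qIm1 (- x) = - qIm1 x"
  "qIm2 (- x) = - qIm2 x" "qIm3 (- x) = - qIm3 x"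
  "qRe (x - y) = qRe x - qRe y" "qIm1 (x - y) = qIm1 x - qIm1 y"
  "qIm2 (x - y) = qIm2 x - qIm2 y" "qIm3 (x - y) = qIm3 x - qIm3 y"
  "qRe (r *\<^sub>R x) = r * qRe x" "qIm1 (r *\<^sub>R x) = r * qIm1 x"
  "qIm2 (r *\<^sub>R x) = r * qIm2 x" "qIm3 (r *\<^sub>R x) = r * qIm3 x"
  "qRe (x * y) = qRe x * qRe y - qIm1 x * qIm1 y - qIm2 x * qIm2 y - qIm3 x * qIm3 y"
  "qIm1 (x * y) = qRe x * qIm1 y + qIm1 x * qRe y + qIm2 x * qIm3 y - qIm3 x * qIm2 y"
  "qIm2 (x * y) = qRe x * qIm2 y - qIm1 x * qIm3 y + qIm2 x * qRe y + qIm3 x * qIm1 y"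
  "qIm3 (x * y) = qRe x * qIm3 y + qIm1 x * qIm2 y - qIm2 x * qIm1 y + qIm3 x * qRe y"
  by (simp_all add: zero_quat_def one_quat_def plus_quat_def uminus_quat_def
      minus_quat_def scaleR_quat_def times_quat_def)

lemma quat_of_real_sel [simp]:
  "qRe (of_real r) = r" "qIm1 (of_real r) = 0" "qIm2 (of_real r) = 0" "qIm3 (of_real r) = 0"
  by (simp_all add: of_real_def)

definition quat_i :: quat where "quat_i = Quat 0 1 0 0"
definition quat_j :: quat where "quat_j = Quat 0 0 1 0"
definition quat_k :: quat where "quat_k = Quat 0 0 0 1"

lemma quat_basis_relations:
  "quat_i * quat_i = -1" "quat_j * quat_j = -1" "quat_k * quat_k = -1"
  "quat_i * quat_j * quat_k = -1"
  by (simp_all add: quat_eq_iff quat_i_def quat_j_def quat_k_def)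

lemma Quat_basis_expansion:
  "Quat a b c d = of_real a + b *\<^sub>R quat_i + c *\<^sub>R quat_j + d *\<^sub>R quat_k"
  by (simp add: quat_eq_iff quat_i_def quat_j_def quat_k_def)

definition qcnj :: "quat \<Rightarrow> quat" where
  "qcnj q = Quat (qRe q) (- qIm1 q) (- qIm2 q) (- qIm3 q)"

lemma qcnj_sel [simp]:
  "qRe (qcnj q) = qRe q" "qIm1 (qcnj q) = - qIm1 q"
  "qIm2 (qcnj q) = - qIm2 q" "qIm3 (qcnj q) = - qIm3 q"
  by (simp_all add: qcnj_def)

lemma qcnj_0 [simp]: "qcnj 0 = 0"
  by (simp add: quat_eq_iff)

lemma qcnj_add: "qcnj (x + y) = qcnj x + qcnj y"
  by (simp add: quat_eq_iff)

lemma qcnj_mult: "qcnj (x * y) = qcnj y * qcnj x"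
  by (simp add: quat_eq_iff)

lemma qcnj_qcnj [simp]: "qcnj (qcnj x) = x"
  by (simp add: quat_eq_iff)

lemma qcnj_sum: "qcnj (sum f S) = (\<Sum>i\<in>S. qcnj (f i))"
  by (induction S rule: infinite_finite_induct) (simp_all add: qcnj_add)

definition ctranspose :: "quat^'n^'m \<Rightarrow> quat^'m^'n" where
  "ctranspose A = (\<chi> i j. qcnj (A $ j $ i))"

definition qhermitian :: "quat^'n^'n \<Rightarrow> bool" where
  "qhermitian A \<longleftrightarrow> A = ctranspose A"

text \<open>The quaternion \<open>x\<^sup>H A x\<close>; the order of the factors matters.\<close>

definition qform :: "quat^'n^'n \<Rightarrow> quat^'n \<Rightarrow> quat" where
  "qform A x = (\<Sum>i\<in>UNIV. qcnj (x $ i) * (A *v x) $ i)"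

lemma qform_column_matrix:
  fixes A :: "quat^'n^'n" and x :: "quat^'n"
  defines "X \<equiv> (\<chi> i j. x $ i) :: quat^1^'n"
  shows "qform A x = (ctranspose X ** (A ** X)) $ 1 $ 1"
  by (simp add: qform_def X_def ctranspose_def matrix_matrix_mult_def matrix_vector_mult_def)

text \<open>For Hermitian \<open>A\<close>, passing from \<open>qform A x\<close> to its real part loses nothing.\<close>

lemma qform_real:
  assumes "qhermitian A"
  shows "qform A x = of_real (qRe (qform A x))"
proof -
  have H: "qcnj (A $ i $ j) = A $ j $ i" for i j
    using assms unfolding qhermitian_def ctranspose_def
    by (metis vec_lambda_beta)
  have "qcnj (qform A x) = (\<Sum>i\<in>UNIV. \<Sum>j\<in>UNIV. qcnj (x $ j) * (A $ j $ i * x $ i))"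
    by (simp add: qform_def matrix_vector_mult_def qcnj_sum qcnj_mult sum_distrib_right H mult.assoc)
  also have "\<dots> = qform A x"
    by (subst sum.swap) (simp add: qform_def matrix_vector_mult_def sum_distrib_left)
  finally show ?thesis
    by (simp add: quat_eq_iff)
qed

end

theory Submission
  imports Defs
begin

text \<open>The range is closed under nonnegative scaling, so it suffices to show that it is closed under
  addition. For \<open>z = x a + y b\<close> the value of the forms is a real-linear function of the
  quaternion Hermitian matrix with diagonal \<open>|a|\<^sup>2, |b|\<^sup>2\<close> and off-diagonal entry
  \<open>b a\<^sup>H\<close>. Such \<open>2 \<times> 2\<close> matrices form a real space of dimension 6, so the linear map into
  \<open>\<real>\<^sup>5\<close> kills some \<open>M \<noteq> 0\<close>. Moving from the identity matrix along \<open>M\<close> up to the boundary of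
  the positive semidefinite cone yields a matrix of rank at most one with the same image
  as the identity, that is, a vector \<open>z\<close> attaining the sum of the values at \<open>x\<close> and \<open>y\<close>.\<close>

definition qsesq :: "quat^'n^'n \<Rightarrow> quat^'n \<Rightarrow> quat^'n \<Rightarrow> quat" where
  "qsesq A x y = (\<Sum>i\<in>UNIV. qcnj (x $ i) * (A *v y) $ i)"

text \<open>Scalars act on the right: right multiplication commutes with \<open>A *v\<close>, which
  left multiplication by a quaternion need not do.\<close>

definition rscale :: "quat^'n \<Rightarrow> quat \<Rightarrow> quat^'n" where
  "rscale x b = (\<chi> i. x $ i * b)"

lemma qform_eq_qsesq: "qform A x = qsesq A x x"
  by (simp add: qform_def qsesq_def)

lemma qsesq_add_left: "qsesq A (x + y) z = qsesq A x z + qsesq A y z"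
  by (simp add: qsesq_def qcnj_add distrib_right sum.distrib)

lemma qsesq_add_right: "qsesq A x (y + z) = qsesq A x y + qsesq A x z"
  by (simp add: qsesq_def matrix_vector_right_distrib distrib_left sum.distrib)

lemma qsesq_rscale_left: "qsesq A (rscale x b) y = qcnj b * qsesq A x y"
  by (simp add: qsesq_def rscale_def qcnj_mult sum_distrib_left mult.assoc)

lemma qsesq_rscale_right: "qsesq A x (rscale y b) = qsesq A x y * b"
  by (simp add: qsesq_def rscale_def matrix_vector_mult_def sum_distrib_right mult.assoc)

lemma qcnj_qsesq:
  assumes "qhermitian A"
  shows "qcnj (qsesq A x y) = qsesq A y x"
proof -
  have H: "qcnj (A $ i $ j) = A $ j $ i" for i j
    using assms unfolding qhermitian_def ctranspose_def
    by (metis vec_lambda_beta)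
  have "qcnj (qsesq A x y) = (\<Sum>i\<in>UNIV. \<Sum>j\<in>UNIV. qcnj (y $ j) * (A $ j $ i * x $ i))"
    by (simp add: qsesq_def matrix_vector_mult_def qcnj_sum qcnj_mult sum_distrib_right H mult.assoc)
  also have "\<dots> = qsesq A y x"
    by (subst sum.swap) (simp add: qsesq_def matrix_vector_mult_def sum_distrib_left)
  finally show ?thesis .
qed

definition qnorm2 :: "quat \<Rightarrow> real" where
  "qnorm2 q = (qRe q)\<^sup>2 + (qIm1 q)\<^sup>2 + (qIm2 q)\<^sup>2 + (qIm3 q)\<^sup>2"

lemma qnorm2_nonneg: "0 \<le> qnorm2 q"
  by (simp add: qnorm2_def)

lemma qnorm2_eq_0_iff: "qnorm2 q = 0 \<longleftrightarrow> q = 0"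
  by (auto simp: qnorm2_def quat_eq_iff add_nonneg_eq_0_iff)

lemma qnorm2_scaleR: "qnorm2 (r *\<^sub>R q) = r\<^sup>2 * qnorm2 q"
  by (simp add: qnorm2_def algebra_simps power2_eq_square)

lemma qnorm2_of_real [simp]: "qnorm2 (of_real r) = r\<^sup>2"
  by (simp add: qnorm2_def)

text \<open>The real part of a product is invariant under cyclic shifts, and
  \<open>b * qcnj b\<close> is the real number \<open>qnorm2 b\<close>.\<close>

lemma qRe_conjugation: "qRe (qcnj b * q * b) = qnorm2 b * qRe q"
  by (simp add: qnorm2_def algebra_simps power2_eq_square)

lemma qRe_qform_rscale: "qRe (qform A (rscale x b)) = qnorm2 b * qRe (qform A x)"
  by (simp only: qform_eq_qsesq qsesq_rscale_left qsesq_rscale_right qRe_conjugation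
      flip: mult.assoc)

lemma qRe_qform_add:
  assumes "qhermitian A"
  shows "qRe (qform A (x + y)) = qRe (qform A x) + qRe (qform A y) + 2 * qRe (qsesq A x y)"
proof -
  have "qRe (qsesq A y x) = qRe (qsesq A x y)"
    by (simp flip: qcnj_qsesq[OF assms, of x y])
  then show ?thesis
    by (simp add: qform_eq_qsesq qsesq_add_left qsesq_add_right)
qed

text \<open>A real first coefficient commutes past \<open>qsesq A x y\<close>, so the value depends
  linearly on \<open>r\<^sup>2\<close>, \<open>qnorm2 b\<close> and \<open>r *\<^sub>R b\<close>,
  the entries of a rank-one matrix.\<close>

lemma qRe_qform_combination:
  assumes "qhermitian A"
  shows "qRe (qform A (rscale x (of_real r) + rscale y b)) =
    r\<^sup>2 * qRe (qform A x) + qnorm2 b * qRe (qform A y) + 2 * qRe (qsesq A x y * (r *\<^sub>R b))"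
proof -
  have "qsesq A (rscale x (of_real r)) (rscale y b) = of_real r * qsesq A x y * b"
    by (simp add: qsesq_rscale_left qsesq_rscale_right mult.assoc qcnj_def of_real_def
        one_quat_def scaleR_quat_def)
  also have "\<dots> = qsesq A x y * (r *\<^sub>R b)"
    by (simp add: quat_eq_iff algebra_simps)
  finally show ?thesis
    by (simp only: qRe_qform_add[OF assms] qRe_qform_rscale qnorm2_of_real)
qed

text \<open>The witness is \<open>l = - 1 / \<mu>\<close> for \<open>\<mu>\<close> the larger eigenvalue of the
  Hermitian matrix with diagonal \<open>s, t\<close> and off-diagonal entry of square modulus \<open>m\<close>.\<close>

lemma psd_boundary_aux:
  fixes s t m :: real
  assumes "0 \<le> m" "0 \<le> s + t" "s \<noteq> 0 \<or> t \<noteq> 0 \<or> m \<noteq> 0"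
  shows "\<exists>l. 0 \<le> 1 + l * s \<and> 0 \<le> 1 + l * t \<and> (1 + l * s) * (1 + l * t) = l\<^sup>2 * m"
proof -
  define D where "D = (s - t)\<^sup>2 + 4 * m"
  define \<mu> where "\<mu> = (s + t + sqrt D) / 2"
  have D: "0 \<le> D" "\<bar>s - t\<bar> \<le> sqrt D"
    using assms(1) by (auto simp: D_def intro!: real_le_rsqrt)
  have \<mu>: "s \<le> \<mu>" "t \<le> \<mu>"
    using D(2) by (auto simp: \<mu>_def)
  have "\<mu> \<noteq> 0"
  proof
    assume "\<mu> = 0"
    then have "s + t + sqrt D = 0"
      by (simp add: \<mu>_def)
    then have "sqrt D = 0" and sum0: "s + t = 0"
      using assms(2) real_sqrt_ge_zero[OF D(1)] by linarith+
    then have "(s - t)\<^sup>2 = 0" "m = 0"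
      using assms(1) by (simp_all add: D_def add_nonneg_eq_0_iff)
    then show False
      using assms(3) sum0 by simp
  qed
  moreover have "0 \<le> \<mu>"
    using assms(2) D(1) by (simp add: \<mu>_def)
  ultimately have pos: "0 < \<mu>"
    by simp
  \<comment> \<open>This is the characteristic equation of the matrix at \<mu>.\<close>
  have char: "(\<mu> - s) * (\<mu> - t) = m"
  proof -
    have "(\<mu> - s) * (\<mu> - t) = ((sqrt D)\<^sup>2 - (s - t)\<^sup>2) / 4"
      by (simp add: \<mu>_def field_simps power2_eq_square)
    then show ?thesis
      using D(1) by (simp add: D_def)
  qed
  have eq: "1 + - (1 / \<mu>) * s = (\<mu> - s) / \<mu>" "1 + - (1 / \<mu>) * t = (\<mu> - t) / \<mu>"
    using pos by (simp_all add: field_simps)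
  show ?thesis
  proof (intro exI conjI)
    show "(1 + - (1 / \<mu>) * s) * (1 + - (1 / \<mu>) * t) = (- (1 / \<mu>))\<^sup>2 * m"
      unfolding eq char[symmetric] by (simp add: power2_eq_square)
  qed (use \<mu> pos in \<open>simp_all only: eq divide_nonneg_pos diff_ge_0_iff_ge\<close>)
qed

text \<open>Negating the matrix together with \<open>l\<close> changes nothing, which reduces to
  nonnegative trace.\<close>

lemma psd_boundary:
  fixes s t m :: real
  assumes "0 \<le> m" "s \<noteq> 0 \<or> t \<noteq> 0 \<or> m \<noteq> 0"
  obtains l where "0 \<le> 1 + l * s" "0 \<le> 1 + l * t" "(1 + l * s) * (1 + l * t) = l\<^sup>2 * m"
proof (cases "0 \<le> s + t")
  case True
  then show ?thesis
    using psd_boundary_aux assms that by blast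
next
  case False
  then obtain l where "0 \<le> 1 + l * - s" "0 \<le> 1 + l * - t"
      "(1 + l * - s) * (1 + l * - t) = l\<^sup>2 * m"
    using psd_boundary_aux[of m "- s" "- t"] assms by auto
  then show ?thesis
    using that[of "- l"] by simp
qed

text \<open>Zero determinant lets \<open>w\<close> be divided by the square root of
  \<open>s\<close>; if \<open>s\<close> vanishes, so does \<open>w\<close>, and only the norm of
  \<open>b\<close> matters.\<close>

lemma rank_one_factorization:
  assumes "0 \<le> s" "0 \<le> t" "s * t = qnorm2 w"
  obtains r b where "r\<^sup>2 = s" "qnorm2 b = t" "r *\<^sub>R b = w"
proof (cases "s = 0")
  case True
  then have "w = 0"
    using assms(3) by (simp flip: qnorm2_eq_0_iff)
  then show ?thesis
    using that[of 0 "of_real (sqrt t)"] True assms(2) by simp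
next
  case False
  then show ?thesis
    using that[of "sqrt s" "(1 / sqrt s) *\<^sub>R w"] assms(1)
    by (simp add: qnorm2_scaleR power_divide flip: assms(3))
qed

lemma linear_nontrivial_kernel:
  fixes f :: "'a::euclidean_space \<Rightarrow> 'b::euclidean_space"
  assumes "linear f" "DIM('b) < DIM('a)"
  obtains v where "v \<noteq> 0" "f v = 0"
proof -
  have "\<not> inj f"
  proof
    assume "inj f"
    then have "dim (range f) = DIM('a)"
      using dim_image_eq[OF assms(1), of UNIV] by simp
    then show False
      using dim_subset_UNIV[of "range f"] assms(2) by simp
  qed
  then show ?thesis
    using that linear_injective_0[OF assms(1)] by blast
qed

lemma qform_range_add:
  fixes A :: "5 \<Rightarrow> quat^'n^'n"
  assumes "\<And>k. qhermitian (A k)"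
  obtains z where "\<And>k. qRe (qform (A k) z) = qRe (qform (A k) x) + qRe (qform (A k) y)"
proof -
  define g :: "real \<times> real \<times> real \<times> real \<times> real \<times> real \<Rightarrow> real^5" where
    "g = (\<lambda>(s, t, c0, c1, c2, c3). \<chi> k. s * qRe (qform (A k) x) + t * qRe (qform (A k) y)
      + 2 * qRe (qsesq (A k) x y * Quat c0 c1 c2 c3))"
  have "linear g"
    by (rule linearI) (auto simp: g_def vec_eq_iff algebra_simps)
  \<comment> \<open>Two real diagonal entries and one quaternion give six parameters, one more than
    the number of forms.\<close>
  then obtain v where "v \<noteq> 0" "g v = 0"
    by (rule linear_nontrivial_kernel) simp
  moreover obtain s t c0 c1 c2 c3 where "v = (s, t, c0, c1, c2, c3)"
    by (metis prod.exhaust)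
  moreover define w where "w = Quat c0 c1 c2 c3"
  ultimately have nz: "s \<noteq> 0 \<or> t \<noteq> 0 \<or> w \<noteq> 0"
    and ker: "s * qRe (qform (A k) x) + t * qRe (qform (A k) y)
      + 2 * qRe (qsesq (A k) x y * w) = 0" for k
    by (auto simp: g_def vec_eq_iff quat_eq_iff zero_prod_def)
  obtain l where l: "0 \<le> 1 + l * s" "0 \<le> 1 + l * t" "(1 + l * s) * (1 + l * t) = l\<^sup>2 * qnorm2 w"
    using psd_boundary[of "qnorm2 w" s t] nz by (auto simp: qnorm2_nonneg qnorm2_eq_0_iff)
  obtain r b where rb: "r\<^sup>2 = 1 + l * s" "qnorm2 b = 1 + l * t" "r *\<^sub>R b = l *\<^sub>R w"
    using rank_one_factorization[of "1 + l * s" "1 + l * t" "l *\<^sub>R w"] l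
    by (auto simp: qnorm2_scaleR)
  show ?thesis
  proof
    fix k
    have "qRe (qform (A k) (rscale x (of_real r) + rscale y b)) =
        qRe (qform (A k) x) + qRe (qform (A k) y) + l * (s * qRe (qform (A k) x)
          + t * qRe (qform (A k) y) + 2 * qRe (qsesq (A k) x y * w))"
      \<comment> \<open>The deviation from the desired sum is \<open>l\<close> times a component of
        \<open>g v\<close>.\<close>
      unfolding qRe_qform_combination[OF assms] rb by (simp add: algebra_simps)
    then show "qRe (qform (A k) (rscale x (of_real r) + rscale y b)) =
        qRe (qform (A k) x) + qRe (qform (A k) y)"
      by (simp only: ker mult_zero_right add_0_right)
  qed
qed

theorem theorem3:
  fixes A :: "5 \<Rightarrow> quat^'n^'n"
  assumes "\<And>k. qhermitian (A k)"
  shows "convex {(\<chi> k. qRe (qform (A k) x)) :: real^5 | x. x \<in> (UNIV :: (quat^'n) set)}"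
proof (rule convexI, safe)
  fix x y :: "quat^'n" and u v :: real
  assume "0 \<le> u" "0 \<le> v"
  \<comment> \<open>The forms are quadratic, so square roots of the weights turn the convex
    combination into a plain sum.\<close>
  obtain z where "\<And>k. qRe (qform (A k) z) = qRe (qform (A k) (rscale x (of_real (sqrt u))))
      + qRe (qform (A k) (rscale y (of_real (sqrt v))))"
    using qform_range_add[of A "rscale x (of_real (sqrt u))" "rscale y (of_real (sqrt v))"] assms
    by blast
  then have "u *\<^sub>R (\<chi> k. qRe (qform (A k) x)) + v *\<^sub>R (\<chi> k. qRe (qform (A k) y)) =
      (\<chi> k. qRe (qform (A k) z))"
    using \<open>0 \<le> u\<close> \<open>0 \<le> v\<close> by (simp add: vec_eq_iff qRe_qform_rscale)
  then show "\<exists>z. u *\<^sub>R (\<chi> k. qRe (qform (A k) x)) + v *\<^sub>R (\<chi> k. qRe (qform (A k) y)) =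
      (\<chi> k. qRe (qform (A k) z)) \<and> z \<in> UNIV"
    by blast
qed

end
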